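(* An open bounded (possibly empty) definable set $X\subset\mathbb{R}^n$ is semi-monotone if and only if for each affine coordinate subspace $S$ of $\mathbb{R}^n$ the intersection $X\cap S$ is connected.
   Context: Fix an o-minimal structure over $\mathbb{R}$; all sets are definable. The empty set is considered connected. A coordinate cone in $\mathbb{R}^n$ is a set $\{x\mid x_{j_1}\sigma_1c_1,\dots,x_{j_m}\sigma_mc_m\}$ with $0\le m\le n$, $1\le j_1<\dots<j_m\le n$, $\sigma_i\in\{<,=,>\}$, $c_i\in\mathbb{R}$ ($m=0$ gives $\mathbb{R}^n$). An affine coordinate subspace is a set $\{x\mid x_{j_1}=c_1,\dots,x_{j_m}=c_m\}$ of this form. An open bounded definable set $X$ is semi-monotone if $X\cap C$ is connected for every coordinate cone $C$. *)

theory Defs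
  imports "HOL-Analysis.Analysis"
begin

text \<open>
  \<open>\<real>\<^sup>n\<close> is the library's \<^const>\<open>Euclidean_space\<close> \<open>n\<close>: functions \<open>x :: nat \<Rightarrow> real\<close> with \<open>x i = 0\<close> for all
  \<open>i \<ge> n\<close>, with the product topology.  The coordinates \<open>x\<^sub>1, \<dots>, x\<^sub>n\<close> are \<open>x 0, \<dots>, x (n - 1)\<close>.
\<close>

abbreviation Rn :: "nat \<Rightarrow> (nat \<Rightarrow> real) set"
  where "Rn n \<equiv> topspace (Euclidean_space n)"

text \<open>
  O-minimal structures on the ordered set \<open>(\<real>, <)\<close> in the sense of van den Dries; \<open>D n\<close> is the
  collection of definable subsets of \<open>\<real>\<^sup>n\<close>.  No algebraic operations are required to be definable,
  so that o-minimal expansions of the real field are a special case.  In \<open>dim1\<close> the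
  intervals may be degenerate or unbounded, so these are the finite unions of points and open
  intervals.
\<close>

locale o_minimal_structure =
  fixes D :: "nat \<Rightarrow> (nat \<Rightarrow> real) set set"
  assumes boolean_algebra: "algebra (Rn n) (D n)"
    and cylinder_right: "A \<in> D n \<Longrightarrow> {x \<in> Rn (Suc n). x(n := 0) \<in> A} \<in> D (Suc n)"
    and cylinder_left: "A \<in> D n \<Longrightarrow> {x \<in> Rn (Suc n). (\<lambda>i. x (Suc i)) \<in> A} \<in> D (Suc n)"
    and diagonal: "i < j \<Longrightarrow> j < n \<Longrightarrow> {x \<in> Rn n. x i = x j} \<in> D n"
    and projection: "A \<in> D (Suc n) \<Longrightarrow> (\<lambda>x. x(n := 0)) ` A \<in> D n"
    and order: "{x \<in> Rn 2. x 0 < x 1} \<in> D 2"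
    and dim1: "D 1 = {{x \<in> Rn 1. x 0 \<in> \<Union>F} | F. finite F \<and> (\<forall>I\<in>F. is_interval I)}"

text \<open>
  The library's \<^const>\<open>bounded\<close> cannot be used here: the metric it provides on \<open>nat \<Rightarrow> real\<close> is
  itself bounded.  \<open>L2_set x {..<n}\<close> is the Euclidean norm of \<open>x\<close>.
\<close>

definition bounded_in_Rn :: "nat \<Rightarrow> (nat \<Rightarrow> real) set \<Rightarrow> bool"
  where "bounded_in_Rn n X \<longleftrightarrow> X \<subseteq> Rn n \<and> (\<exists>B. \<forall>x\<in>X. L2_set x {..<n} \<le> B)"

text \<open>\<open>J\<close> is the set of the indices \<open>j\<^sub>1 < \<dots> < j\<^sub>m\<close>.\<close>

definition coordinate_cone :: "nat \<Rightarrow> (nat \<Rightarrow> real) set \<Rightarrow> bool"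
  where "coordinate_cone n C \<longleftrightarrow>
    (\<exists>J \<sigma> c. J \<subseteq> {..<n} \<and> (\<forall>j\<in>J. \<sigma> j \<in> {(<), (=), (>)}) \<and>
             C = {x \<in> Rn n. \<forall>j\<in>J. \<sigma> j (x j) (c j)})"

definition affine_coordinate_subspace :: "nat \<Rightarrow> (nat \<Rightarrow> real) set \<Rightarrow> bool"
  where "affine_coordinate_subspace n S \<longleftrightarrow>
    (\<exists>J c. J \<subseteq> {..<n} \<and> S = {x \<in> Rn n. \<forall>j\<in>J. x j = c j})"

definition semi_monotone ::
    "(nat \<Rightarrow> (nat \<Rightarrow> real) set set) \<Rightarrow> nat \<Rightarrow> (nat \<Rightarrow> real) set \<Rightarrow> bool"
  where "semi_monotone D n X \<longleftrightarrow>
    openin (Euclidean_space n) X \<and> bounded_in_Rn n X \<and> X \<in> D n \<and>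
    (\<forall>C. coordinate_cone n C \<longrightarrow> connectedin (Euclidean_space n) (X \<inter> C))"

end

theory Submission
  imports Defs
begin

text \<open>
  Let \<open>p\<close> be the projection to the \<open>k\<close>-th coordinate. On a relatively open subset \<open>Y\<close> of an affine
  coordinate subspace that does not fix \<open>x\<^sub>k\<close>, \<open>p\<close> is an open map onto its image. If \<open>Y\<close> and all fibres
  \<open>Y \<inter> {x\<^sub>k = t}\<close> are connected, then so is \<open>Y \<inter> {x\<^sub>k \<in> I}\<close> for every interval \<open>I\<close>: the set \<open>p Y \<inter> I\<close>
  is an interval, and the preimage of a connected set under an open map with connected fibres is
  connected. Strict inequalities can therefore be added to the equations one at a time.
\<close>

text \<open>\<open>Euclidean_space n\<close> is a subspace of \<open>nat \<Rightarrow> real\<close>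
  with its type class product topology, so connectedness of a subset can be tested there.\<close>

lemma connectedin_Euclidean_space:
  "connectedin (Euclidean_space n) A \<longleftrightarrow> A \<subseteq> Rn n \<and> connected A"
  unfolding topspace_Euclidean_space Euclidean_space_def euclidean_product_topology
  by (auto simp: connectedin_subtopology)

lemma openin_Euclidean_space:
  "openin (Euclidean_space n) X \<longleftrightarrow> (\<exists>T. open T \<and> X = T \<inter> Rn n)"
  unfolding topspace_Euclidean_space Euclidean_space_def euclidean_product_topology
  by (simp add: openin_subtopology)

lemma continuous_fun_upd:
  fixes x :: "'a \<Rightarrow> 'b::topological_space"
  shows "continuous_on UNIV (\<lambda>t. x(k := t))"
proof (rule continuous_on_coordinatewise_then_product)
  show "continuous_on UNIV (\<lambda>t. (x(k := t)) i)" for i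
    by (cases "i = k") simp_all
qed

text \<open>As \<open>S\<close> is a union of lines in direction \<open>k\<close>, the image is the
  union over \<open>x\<close> in \<open>S\<close> of the preimages of \<open>W\<close> under
  \<open>\<lambda>t. x(k := t)\<close>, each open by continuity.\<close>

lemma open_coordinate_image:
  fixes W S :: "('a \<Rightarrow> 'b::topological_space) set"
  assumes "open W" and "\<And>x t. x \<in> S \<Longrightarrow> x(k := t) \<in> S"
  shows "open ((\<lambda>x. x k) ` (W \<inter> S))"
proof -
  have "(\<lambda>x. x k) ` (W \<inter> S) = (\<Union>x\<in>S. (\<lambda>t. x(k := t)) -` W)"
  proof (intro equalityI subsetI)
    fix t assume "t \<in> (\<lambda>x. x k) ` (W \<inter> S)"
    then obtain x where "x \<in> W" "x \<in> S" "t = x k" by blast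
    then show "t \<in> (\<Union>x\<in>S. (\<lambda>t. x(k := t)) -` W)"
      by (intro UN_I[of x]) auto
  next
    fix t assume "t \<in> (\<Union>x\<in>S. (\<lambda>t. x(k := t)) -` W)"
    then obtain x where "x \<in> S" "x(k := t) \<in> W" by blast
    with assms(2) show "t \<in> (\<lambda>x. x k) ` (W \<inter> S)"
      by (intro image_eqI[of _ _ "x(k := t)"]) auto
  qed
  moreover have "open ((\<lambda>t. x(k := t)) -` W)" for x
    using assms(1) continuous_fun_upd by (rule open_vimage)
  then have "open (\<Union>x\<in>S. (\<lambda>t. x(k := t)) -` W)"
    by (intro open_UN ballI)
  ultimately show ?thesis by (simp only:)
qed

text \<open>The closure condition on \<open>S\<close> abstracts an affine coordinate subspace in
  which the coordinate \<open>k\<close> is free.\<close>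

lemma connected_coordinate_slab:
  fixes S :: "('a \<Rightarrow> real) set"
  assumes Y: "Y = W \<inter> S" "open W"
    and S: "\<And>x t. x \<in> S \<Longrightarrow> x(k := t) \<in> S"
    and "connected Y"
    and fibres: "\<And>t. connected (Y \<inter> {x. x k = t})"
    and I: "connected I"
  shows "connected (Y \<inter> {x. x k \<in> I})"
proof -
  define p where "p = (\<lambda>x :: 'a \<Rightarrow> real. x k)"
  have cont: "continuous_on Y p"
    unfolding p_def by (rule continuous_on_subset[OF continuous_on_product_coordinates]) simp
  have "connected (p ` Y)"
    using cont \<open>connected Y\<close> by (rule connected_continuous_image)
  with I have "connected (p ` Y \<inter> I)"
    by (meson is_interval_connected_1 is_interval_Int)
  then have "connected (Y \<inter> p -` (p ` Y \<inter> I))"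
  proof (rule connected_open_monotone_preimage[OF cont refl, rotated 2])
    fix C assume "openin (top_of_set Y) C"
    then obtain U where U: "open U" "C = Y \<inter> U" by (auto simp: openin_open)
    \<comment> \<open>\<open>C\<close> equals \<open>(W \<inter> U) \<inter> S\<close>, so its image
      is open even in the real line.\<close>
    have "open (p ` C)"
      unfolding p_def using open_coordinate_image[of "W \<inter> U" S k] U Y S
      by (simp add: Int_ac open_Int)
    then show "openin (top_of_set (p ` Y)) (p ` C)"
      using U by (intro open_subset) auto
  next
    show "connected (Y \<inter> p -` {t})" for t
      using fibres[of t] by (simp add: p_def vimage_def)
  qed auto
  moreover have "Y \<inter> p -` (p ` Y \<inter> I) = Y \<inter> {x. x k \<in> I}"
    by (auto simp: p_def)
  ultimately show ?thesis by simp
qed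

text \<open>\<open>J\<close> and \<open>c\<close> vary in the induction on \<open>K\<close>: fixing
  the coordinate \<open>k\<close> at \<open>t\<close> moves \<open>k\<close> from the interval
  conditions to the equations. Both the box without the condition on \<open>k\<close> and its fibres
  are thus covered by the induction hypothesis.\<close>

lemma connected_coordinate_box:
  fixes c :: "nat \<Rightarrow> real"
  assumes X: "openin (Euclidean_space n) X"
    and sub: "\<And>S. affine_coordinate_subspace n S \<Longrightarrow> connected (X \<inter> S)"
    and "finite K" "K \<subseteq> {..<n}" "J \<subseteq> {..<n}" "J \<inter> K = {}"
    and "\<And>k. k \<in> K \<Longrightarrow> open (I k) \<and> connected (I k)"
  shows "connected (X \<inter> {x \<in> Rn n. (\<forall>j\<in>J. x j = c j) \<and> (\<forall>k\<in>K. x k \<in> I k)})"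
  using assms(3-)
proof (induction K arbitrary: J c rule: finite_induct)
  case empty
  then have "affine_coordinate_subspace n {x \<in> Rn n. \<forall>j\<in>J. x j = c j}"
    unfolding affine_coordinate_subspace_def by blast
  from sub[OF this] show ?case by simp
next
  case (insert k K)
  let ?box = "\<lambda>J c. X \<inter> {x \<in> Rn n. (\<forall>j\<in>J. x j = c j) \<and> (\<forall>k\<in>K. x k \<in> I k)}"
  obtain T where T: "open T" "X = T \<inter> Rn n"
    using X by (auto simp: openin_Euclidean_space)
  \<comment> \<open>The remaining interval conditions are absorbed into the open factor
    \<open>?W\<close>, open because \<open>K\<close> is finite; only the equations go into
    \<open>?S\<close>.\<close>
  have "open ((\<lambda>x :: nat \<Rightarrow> real. x i) -` I i)" if "i \<in> K" for i
    using that insert.prems by (intro open_vimage) simp_all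
  with insert.hyps have "open (\<Inter>k\<in>K. (\<lambda>x :: nat \<Rightarrow> real. x k) -` I k)"
    by (intro open_INT) simp_all
  with T(1) have "open (T \<inter> (\<Inter>k\<in>K. (\<lambda>x. x k) -` I k))" (is "open ?W")
    by (rule open_Int)
  let ?S = "{x \<in> Rn n. \<forall>j\<in>J. x j = c j}"
  have "connected (?box J c \<inter> {x. x k \<in> I k})"
  proof (rule connected_coordinate_slab[of _ ?W ?S])
    show "?box J c = ?W \<inter> ?S" using T(2) by auto
    show "open ?W" by fact
    \<comment> \<open>Here \<open>k < n\<close> keeps the point in \<open>Rn n\<close>, and
      \<open>k \<notin> J\<close> preserves the equations.\<close>
    show "x(k := t) \<in> ?S" if "x \<in> ?S" for x t
      using that insert.prems by (auto simp: topspace_Euclidean_space)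
    show "connected (?box J c)"
      using insert.prems by (intro insert.IH) auto
    show "connected (I k)" using insert.prems by auto
    fix t
    \<comment> \<open>Since \<open>k \<notin> J\<close>, overriding \<open>c\<close> at
      \<open>k\<close> adds the equation for \<open>t\<close> without altering the others.\<close>
    have "connected (?box (insert k J) (c(k := t)))"
      using insert.hyps insert.prems by (intro insert.IH) auto
    moreover have "?box (insert k J) (c(k := t)) = ?box J c \<inter> {x. x k = t}"
      using insert.prems by fastforce
    ultimately show "connected (?box J c \<inter> {x. x k = t})" by simp
  qed
  also have "?box J c \<inter> {x. x k \<in> I k}
    = X \<inter> {x \<in> Rn n. (\<forall>j\<in>J. x j = c j) \<and> (\<forall>k\<in>insert k K. x k \<in> I k)}"
    by auto
  finally show ?case .
qed

lemma affine_coordinate_subspace_imp_cone: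
  assumes "affine_coordinate_subspace n S"
  shows "coordinate_cone n S"
proof -
  from assms obtain J c where "J \<subseteq> {..<n}" "S = {x \<in> Rn n. \<forall>j\<in>J. x j = c j}"
    unfolding affine_coordinate_subspace_def by blast
  then show ?thesis
    unfolding coordinate_cone_def
    by (intro exI[of _ J] exI[of _ "\<lambda>_. (=)"] exI[of _ c]) auto
qed

text \<open>A cone is a box: the indices in \<open>E\<close> carry equations, and each other index
  in \<open>J\<close> restricts its coordinate to an open ray.\<close>

lemma connected_coordinate_cone:
  assumes X: "openin (Euclidean_space n) X"
    and sub: "\<And>S. affine_coordinate_subspace n S \<Longrightarrow> connected (X \<inter> S)"
    and "coordinate_cone n C"
  shows "connected (X \<inter> C)"
proof -
  from assms(3) obtain J \<sigma> c where J: "J \<subseteq> {..<n}"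
    and \<sigma>: "\<And>j. j \<in> J \<Longrightarrow> \<sigma> j \<in> {(<), (=), (>)}"
    and C: "C = {x \<in> Rn n. \<forall>j\<in>J. \<sigma> j (x j) (c j)}"
    unfolding coordinate_cone_def by blast
  define E where "E = {j \<in> J. \<sigma> j = (=)}"
  have "connected (X \<inter> {x \<in> Rn n. (\<forall>j\<in>E. x j = c j) \<and> (\<forall>k\<in>J - E. x k \<in> {t. \<sigma> k t (c k)})})"
  proof (rule connected_coordinate_box[OF X sub])
    show "finite (J - E)" using J finite_subset by blast
    fix k assume "k \<in> J - E"
    then consider "\<sigma> k = (<)" | "\<sigma> k = (>)" using \<sigma> by (auto simp: E_def)
    then show "open {t. \<sigma> k t (c k)} \<and> connected {t. \<sigma> k t (c k)}"
      by cases (simp_all flip: lessThan_def greaterThan_def)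
  qed (use J in \<open>auto simp: E_def\<close>)
  moreover have "{x \<in> Rn n. (\<forall>j\<in>E. x j = c j) \<and> (\<forall>k\<in>J - E. x k \<in> {t. \<sigma> k t (c k)})} = C"
    unfolding C E_def by auto
  ultimately show ?thesis by simp
qed

theorem theorem1p4:
  fixes D :: "nat \<Rightarrow> (nat \<Rightarrow> real) set set"
    and n :: nat
    and X :: "(nat \<Rightarrow> real) set"
  assumes "o_minimal_structure D"
    and "openin (Euclidean_space n) X"
    and "bounded_in_Rn n X"
    and "X \<in> D n"
  shows "semi_monotone D n X \<longleftrightarrow>
    (\<forall>S. affine_coordinate_subspace n S \<longrightarrow> connectedin (Euclidean_space n) (X \<inter> S))"
proof
  assume "semi_monotone D n X"
  then show "\<forall>S. affine_coordinate_subspace n S \<longrightarrow> connectedin (Euclidean_space n) (X \<inter> S)"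
    by (auto simp: semi_monotone_def dest: affine_coordinate_subspace_imp_cone)
next
  assume "\<forall>S. affine_coordinate_subspace n S \<longrightarrow> connectedin (Euclidean_space n) (X \<inter> S)"
  then have sub: "\<And>S. affine_coordinate_subspace n S \<Longrightarrow> connected (X \<inter> S)"
    by (simp add: connectedin_Euclidean_space)
  \<comment> \<open>\<open>connectedin\<close> also demands inclusion in \<open>Rn n\<close>, which
    \<open>X \<inter> C\<close> inherits from \<open>X\<close>.\<close>
  have "X \<subseteq> Rn n" using assms(2) by (rule openin_subset)
  then show "semi_monotone D n X"
    using assms connected_coordinate_cone[OF assms(2) sub]
    by (auto simp: semi_monotone_def connectedin_Euclidean_space)
qed

end
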